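(* Assume (i) each $f_i$ is convex and $L_i$-smooth, (ii) $f$ is $\mu$-strongly convex, and (iii) for all $w$, $\mathbb{E}_i\|\nabla f_i(w)-\nabla f(w)\|^2\le\sigma^2$. Let $T$ be the number of iterations, $1\le\beta<T$, $\alpha=(\beta/T)^{1/T}$. Consider ASGD, $$y_k=w_k+b_k(w_k-w_{k-1}),\qquad w_{k+1}=y_k-\gamma_k\alpha_k^2\nabla f_{i_k}(y_k),$$ with $w_1=y_1$, $\gamma_k=\frac1L$, $\alpha_k=\left(\frac\beta T\right)^{k/T}$, $r_k=\sqrt{\frac\mu L}\left(\frac\beta T\right)^{k/T}$ and $b_k=\frac{(1-r_{k-1})\,r_{k-1}\,\alpha^2}{r_k+r_{k-1}^2\,\alpha^2}$. Then $$\Delta_{T+1}\le2c_3\exp\left(-\frac{T}{\sqrt\kappa}\frac{\alpha}{\ln(T/\beta)}\right)\Delta_1+\frac{4\sigma^2c_3}{\mu e^2}\frac{(\ln(T/\beta))^2}{\alpha^2T},$$ where $\Delta_k:=\mathbb{E}[f(w_k)-f^*]$ and $c_3=\exp\left(\frac{2\beta}{\sqrt\kappa\ln(T/\beta)}\right)$.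
   Context: $f:\mathbb{R}^d\to\mathbb{R}$ is $f(w)=\frac1n\sum_{i=1}^nf_i(w)$, where each $f_i:\mathbb{R}^d\to\mathbb{R}$ is differentiable and bounded below. $L_i$-smooth means $f_i(v)\le f_i(w)+\langle\nabla f_i(w),v-w\rangle+\frac{L_i}{2}\|v-w\|^2$ for all $v,w$. $f$ is $\mu$-strongly convex ($\mu>0$) if $f(v)\ge f(w)+\langle\nabla f(w),v-w\rangle+\frac\mu2\|v-w\|^2$ for all $v,w$. Set $L:=\max_iL_i$, $\kappa:=L/\mu$, $f^*:=\min f$. $\mathbb{E}_i$ is expectation over $i$ uniform in $\{1,\dots,n\}$. The point $w_1=y_1$ is deterministic; the extrapolation step defining $y_k$ is applied for $k\ge2$ and the gradient step for $k=1,\dots,T$; the indices $i_k$ are drawn independently and uniformly from $\{1,\dots,n\}$, and $\mathbb{E}$ is over all these draws. *)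

theory Defs
  imports "HOL-Probability.Probability"
begin

(* The gradient is the vector D with (\<lambda>h. h \<bullet> D) as Frechet derivative; it is unique when it
   exists, and unspecified at points where f is not differentiable. *)
definition grad :: "('a::real_inner \<Rightarrow> real) \<Rightarrow> 'a \<Rightarrow> 'a" where
  "grad f w = (THE D. GDERIV f w :> D)"

definition smooth_with :: "real \<Rightarrow> ('a::real_inner \<Rightarrow> real) \<Rightarrow> bool" where
  "smooth_with L f \<longleftrightarrow>
     (\<forall>v w. f v \<le> f w + grad f w \<bullet> (v - w) + L / 2 * (norm (v - w))\<^sup>2)"

definition strongly_convex_with :: "real \<Rightarrow> ('a::real_inner \<Rightarrow> real) \<Rightarrow> bool" where
  "strongly_convex_with \<mu> f \<longleftrightarrow> \<mu> > 0 \<and>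
     (\<forall>v w. f v \<ge> f w + grad f w \<bullet> (v - w) + \<mu> / 2 * (norm (v - w))\<^sup>2)"

end

theory Submission
  imports Defs
begin

text \<open>The argument is a Lyapunov argument for Nesterov's method. Write $\eta_k = \alpha^{2k}/L$ for the
  effective step size. The schedule is chosen so that $r_k^2 = \mu\,\eta_k$ and
  $r_k = \alpha\, r_{k-1}$; these two relations turn the prescribed extrapolation coefficient
  into the one of Nesterov's method with varying steps, which means that
  $(1 + r_k)\, y_k = r_k v_k + w_k$ for the hidden momentum sequence $v_1 = w_1$,
  $v_k = w_{k-1} + (w_k - w_{k-1})/r_{k-1}$. Let $u$ be the minimiser of $f$ and
  $P_k = f(w_k) - f(u) + \frac{\mu}{2}\|v_k - u\|^2$.

  Averaged over the index drawn at step $k$, the potential satisfies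
  $\mathbb{E} P_{k+1} \le (1 - r_k)\, \mathbb{E} P_k + \eta_k \sigma^2$
  (\<open>accelerated_potential_step\<close>). Smoothness and the momentum update each
  contribute at most $\frac{\eta_k}{2}\|\nabla f_i(y_k)\|^2$; since the mean of $\|\nabla f_i(y_k)\|^2$ is
  $\|\nabla f(y_k)\|^2$ plus the variance, the decrease $\eta_k\|\nabla f(y_k)\|^2$ along the
  gradient pays for them up to $\eta_k$ times the variance, and what remains is the
  deterministic potential inequality.
  Passing from this average to an expectation over all draws uses that the state
  $(w_k, v_k)$ is a function of the earlier indices and hence independent of the index drawn
  at step $k$ (\<open>expected_potential_step\<close>).

  It remains to unroll the recursion. With $l = \ln(T/\beta)$ one has $\alpha^T = \beta/T$ and
  $\ln(1/\alpha) = l/T$, so $\alpha\, l/T \le 1 - \alpha \le l/T$. The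
  geometric tail $\sum_{i=k+1}^{T} \alpha^i = (\alpha^{k+1} - \alpha^{T+1})/(1-\alpha)$ is
  therefore $\alpha^{k+1}/(1-\alpha)$ up to a correction that the factor $c_3$ absorbs. The initial
  potential is at most $2 \Delta_1$ by quadratic growth, which gives the first term of the
  bound. For the noise, $e^{-x} \le 4/(e x)^2$ at $x = \alpha^{k+1}/(\sqrt{\kappa}(1-\alpha))$
  cancels the factor $\alpha^{2k}$ in $\eta_k$, so that all $T$ summands obey the same bound.\<close>

section \<open>Gradients and minimisers\<close>

lemma GDERIV_unique:
  fixes f :: "'a::real_inner \<Rightarrow> real"
  assumes "GDERIV f w :> D" "GDERIV f w :> D'"
  shows "D = D'"
proof -
  have "(\<lambda>h. h \<bullet> D) = (\<lambda>h. h \<bullet> D')"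
    using assms has_derivative_unique unfolding gderiv_def by blast
  then have "\<forall>h. h \<bullet> D = h \<bullet> D'"
    by (simp add: fun_eq_iff)
  then show ?thesis
    by (simp only: vector_eq_ldot)
qed

lemma grad_eqI: "GDERIV f w :> D \<Longrightarrow> grad f w = D"
  unfolding grad_def using GDERIV_unique by blast

lemma differentiable_imp_GDERIV_grad:
  fixes f :: "'a::euclidean_space \<Rightarrow> real"
  assumes "f differentiable (at w)"
  shows "GDERIV f w :> grad f w"
proof -
  obtain f' where f': "(f has_derivative f') (at w)"
    using assms by (auto simp: differentiable_def)
  have "linear f'"
    using f' by (rule has_derivative_linear)
  have riesz: "f' h = h \<bullet> (\<Sum>b\<in>Basis. f' b *\<^sub>R b)" for h
  proof -
    have "f' h = f' (\<Sum>b\<in>Basis. (h \<bullet> b) *\<^sub>R b)"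
      by (simp add: euclidean_representation)
    also have "\<dots> = (\<Sum>b\<in>Basis. (h \<bullet> b) * f' b)"
      by (simp add: linear_sum[OF \<open>linear f'\<close>] linear_scale[OF \<open>linear f'\<close>])
    finally show ?thesis
      by (simp add: inner_sum_right mult.commute)
  qed
  have deriv: "GDERIV f w :> (\<Sum>b\<in>Basis. f' b *\<^sub>R b)"
    unfolding gderiv_def using f' by (rule has_derivative_eq_rhs) (rule ext, rule riesz)
  then show ?thesis
    by (simp only: grad_eqI[OF deriv])
qed

lemma GDERIV_scaled_sum:
  fixes g :: "'i \<Rightarrow> 'a::real_inner \<Rightarrow> real"
  assumes "\<And>i. i \<in> I \<Longrightarrow> GDERIV (g i) w :> D i"
  shows "GDERIV (\<lambda>v. c * (\<Sum>i\<in>I. g i v)) w :> c *\<^sub>R (\<Sum>i\<in>I. D i)"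
proof -
  have "((\<lambda>v. c * (\<Sum>i\<in>I. g i v)) has_derivative (\<lambda>h. c * (\<Sum>i\<in>I. h \<bullet> D i))) (at w)"
    using assms unfolding gderiv_def by (intro has_derivative_mult_right has_derivative_sum) auto
  then show ?thesis
    by (simp add: gderiv_def inner_sum_right)
qed

text \<open>Comparing the quadratic lower and upper bounds of $f$ at two distinct points; this
  keeps the contraction factors $1 - \sqrt{\mu\eta_k}$ nonnegative.\<close>

lemma strongly_convex_smooth_le:
  fixes f :: "'a::euclidean_space \<Rightarrow> real"
  assumes "strongly_convex_with \<mu> f" "smooth_with L f"
  shows "\<mu> \<le> L"
proof -
  obtain b :: 'a where b: "b \<in> Basis"
    using nonempty_Basis by blast
  have "f b \<ge> f 0 + grad f 0 \<bullet> (b - 0) + \<mu> / 2 * (norm (b - 0))\<^sup>2"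
    using assms unfolding strongly_convex_with_def by blast
  moreover have "f b \<le> f 0 + grad f 0 \<bullet> (b - 0) + L / 2 * (norm (b - 0))\<^sup>2"
    using assms unfolding smooth_with_def by blast
  ultimately show ?thesis
    using b by simp
qed

text \<open>Existence: outside the ball of radius $2\|\nabla f(0)\|/\mu$ the quadratic term of the
  strong convexity bound at $0$ dominates the linear one, so $f \ge f(0)$ there, and inside the
  ball compactness applies. Growth: the gradient vanishes at a minimiser.\<close>

lemma strongly_convex_minimiser:
  fixes f :: "'a::euclidean_space \<Rightarrow> real"
  assumes sc: "strongly_convex_with \<mu> f" and diff: "\<And>v. f differentiable (at v)"
  obtains u where "\<And>v. f u \<le> f v" "\<And>v. f u + \<mu> / 2 * (norm (v - u))\<^sup>2 \<le> f v"
proof -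
  have \<mu>: "\<mu> > 0" and lower: "f w + grad f w \<bullet> (v - w) + \<mu> / 2 * (norm (v - w))\<^sup>2 \<le> f v" for v w
    using sc unfolding strongly_convex_with_def by auto
  define R where "R = 2 * norm (grad f 0) / \<mu>"
  have "continuous_on (cball 0 R) f"
    by (intro continuous_at_imp_continuous_on ballI differentiable_imp_continuous_within diff)
  moreover have "(0::'a) \<in> cball 0 R"
    using \<mu> by (simp add: R_def)
  ultimately obtain u where u: "\<And>v. v \<in> cball 0 R \<Longrightarrow> f u \<le> f v"
    using continuous_attains_inf[OF compact_cball] by (metis empty_iff)
  have min: "f u \<le> f v" for v
  proof (cases "norm v \<le> R")
    case True
    then show ?thesis using u by simp
  next
    case False
    have "norm (grad f 0) \<le> \<mu> / 2 * norm v"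
      using False \<mu> by (simp add: R_def field_simps)
    then have "norm (grad f 0) * norm v \<le> \<mu> / 2 * norm v * norm v"
      by (intro mult_right_mono) auto
    moreover have "- (norm (grad f 0) * norm v) \<le> grad f 0 \<bullet> v"
      using Cauchy_Schwarz_ineq2[of "grad f 0" v] by linarith
    ultimately have "0 \<le> grad f 0 \<bullet> (v - 0) + \<mu> / 2 * (norm (v - 0))\<^sup>2"
      by (simp add: power2_eq_square)
    then have "f 0 \<le> f v"
      using lower[of 0 v] by linarith
    moreover have "f u \<le> f 0"
      using \<open>0 \<in> cball 0 R\<close> u by blast
    ultimately show ?thesis by linarith
  qed
  have "(f has_derivative (\<lambda>h. h \<bullet> grad f u)) (at u)"
    using differentiable_imp_GDERIV_grad[OF diff] by (simp add: gderiv_def)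
  then have "(\<lambda>h. h \<bullet> grad f u) = (\<lambda>h. 0)"
    by (rule has_derivative_local_min) (simp add: min)
  then have "grad f u \<bullet> grad f u = 0"
    by (rule fun_cong)
  then have "grad f u = 0"
    by simp
  then have "f u + \<mu> / 2 * (norm (v - u))\<^sup>2 \<le> f v" for v
    using lower[of u v] by simp
  with min show thesis using that by blast
qed

section \<open>One accelerated step\<close>

text \<open>One step of Nesterov's method from the state $(x, v)$ with extrapolated point $y$ and stochastic
  gradients \<open>D i\<close>, in the regime $\theta^2 = \mu\eta$, where the curvature of the
  potential stays equal to $\mu$. The new momentum point is a convex combination
  $z = (1-\theta) v + \theta y$ moved by $-(\theta/\mu)\, D_i$, so it adds
  $\frac{\mu}{2}(\theta/\mu)^2\|D_i\|^2 = \frac{\eta}{2}\|D_i\|^2$, as much as the descent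
  inequality adds when $L\eta \le 1$; both are paid for by the decrease along the gradient.\<close>

lemma accelerated_potential_step:
  fixes f :: "'a::real_inner \<Rightarrow> real" and D :: "'i \<Rightarrow> 'a"
  assumes I: "finite I" "I \<noteq> {}"
    and lower: "\<And>u. f y + G \<bullet> (u - y) + \<mu> / 2 * (norm (u - y))\<^sup>2 \<le> f u"
    and upper: "\<And>u. f u \<le> f y + G \<bullet> (u - y) + L / 2 * (norm (u - y))\<^sup>2"
    and mean: "(\<Sum>i\<in>I. D i) = real (card I) *\<^sub>R G"
    and var: "(\<Sum>i\<in>I. (norm (D i - G))\<^sup>2) / real (card I) \<le> \<sigma>\<^sup>2"
    and \<mu>: "\<mu> > 0" and \<eta>: "\<eta> > 0" "L * \<eta> \<le> 1"
    and \<theta>: "0 < \<theta>" "\<theta> \<le> 1" "\<theta>\<^sup>2 = \<mu> * \<eta>"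
    and y: "(1 + \<theta>) *\<^sub>R y = \<theta> *\<^sub>R v + x"
  shows "(\<Sum>i\<in>I. f (y - \<eta> *\<^sub>R D i) - f u
            + \<mu> / 2 * (norm (x + (1 / \<theta>) *\<^sub>R (y - \<eta> *\<^sub>R D i - x) - u))\<^sup>2) / real (card I)
         \<le> (1 - \<theta>) * (f x - f u + \<mu> / 2 * (norm (v - u))\<^sup>2) + \<eta> * \<sigma>\<^sup>2"
proof -
  define z where "z = (1 - \<theta>) *\<^sub>R v + \<theta> *\<^sub>R y"
  have x: "x = (1 + \<theta>) *\<^sub>R y - \<theta> *\<^sub>R v"
    using y by simp
  have \<theta>z: "\<theta> *\<^sub>R z = y - (1 - \<theta>) *\<^sub>R x"
    unfolding z_def x by (simp add: algebra_simps)
  have next_v: "x + (1 / \<theta>) *\<^sub>R (y - \<eta> *\<^sub>R D i - x) = z - (\<theta> / \<mu>) *\<^sub>R D i" for i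
  proof -
    have "\<theta> * (\<theta> / \<mu>) = \<eta>"
      using \<mu> \<theta>(3) by (simp add: power2_eq_square field_simps)
    then have "\<theta> *\<^sub>R (x + (1 / \<theta>) *\<^sub>R (y - \<eta> *\<^sub>R D i - x)) = \<theta> *\<^sub>R (z - (\<theta> / \<mu>) *\<^sub>R D i)"
      using \<theta>(1) \<theta>z by (simp add: algebra_simps)
    then show ?thesis using \<theta>(1) by simp
  qed
  define C where "C = f y - f u + \<mu> / 2 * (norm (z - u))\<^sup>2"
  \<comment> \<open>Written as a part affine in the gradient plus its squared deviation from the mean, so
    that summation over the indices is immediate.\<close>
  have each: "f (y - \<eta> *\<^sub>R D i) - f u + \<mu> / 2 * (norm (x + (1 / \<theta>) *\<^sub>R (y - \<eta> *\<^sub>R D i - x) - u))\<^sup>2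
     \<le> C - \<eta> * (norm G)\<^sup>2 + (\<eta> *\<^sub>R G - \<theta> *\<^sub>R (z - u)) \<bullet> D i + \<eta> * (norm (D i - G))\<^sup>2" for i
  proof -
    have "f (y - \<eta> *\<^sub>R D i) \<le> f y - \<eta> * (G \<bullet> D i) + L / 2 * (\<eta>\<^sup>2 * (norm (D i))\<^sup>2)"
      using upper[of "y - \<eta> *\<^sub>R D i"] by (simp add: power_mult_distrib)
    also have "L / 2 * (\<eta>\<^sup>2 * (norm (D i))\<^sup>2) = (L * \<eta>) * (\<eta> / 2 * (norm (D i))\<^sup>2)"
      by (simp add: power2_eq_square)
    also have "\<dots> \<le> 1 * (\<eta> / 2 * (norm (D i))\<^sup>2)"
      using \<eta> by (intro mult_right_mono) auto
    finally have descent: "f (y - \<eta> *\<^sub>R D i) \<le> f y - \<eta> * (G \<bullet> D i) + \<eta> / 2 * (norm (D i))\<^sup>2"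
      by simp
    have "(norm (z - (\<theta> / \<mu>) *\<^sub>R D i - u))\<^sup>2
        = (norm (z - u))\<^sup>2 - 2 * (\<theta> / \<mu>) * ((z - u) \<bullet> D i) + (\<theta> / \<mu>)\<^sup>2 * (norm (D i))\<^sup>2"
      unfolding power2_norm_eq_inner by (simp add: inner_diff inner_commute power2_eq_square algebra_simps)
    then have "\<mu> / 2 * (norm (z - (\<theta> / \<mu>) *\<^sub>R D i - u))\<^sup>2
        = \<mu> / 2 * (norm (z - u))\<^sup>2 - \<theta> * ((z - u) \<bullet> D i) + (\<theta>\<^sup>2 / \<mu>) / 2 * (norm (D i))\<^sup>2"
      using \<mu> by (simp add: field_simps power2_eq_square)
    also have "\<theta>\<^sup>2 / \<mu> = \<eta>"
      using \<mu> \<theta>(3) by simp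
    finally have momentum: "\<mu> / 2 * (norm (z - (\<theta> / \<mu>) *\<^sub>R D i - u))\<^sup>2
        = \<mu> / 2 * (norm (z - u))\<^sup>2 - \<theta> * ((z - u) \<bullet> D i) + \<eta> / 2 * (norm (D i))\<^sup>2" .
    have dev: "(norm (D i - G))\<^sup>2 = (norm (D i))\<^sup>2 - 2 * (G \<bullet> D i) + (norm G)\<^sup>2"
      unfolding power2_norm_eq_inner by (simp add: inner_diff inner_commute)
    have "\<eta> * (norm (D i - G))\<^sup>2 = \<eta> * (norm (D i))\<^sup>2 - 2 * \<eta> * (G \<bullet> D i) + \<eta> * (norm G)\<^sup>2"
      unfolding dev by (simp add: algebra_simps)
    moreover have "(\<eta> *\<^sub>R G - \<theta> *\<^sub>R (z - u)) \<bullet> D i = \<eta> * (G \<bullet> D i) - \<theta> * ((z - u) \<bullet> D i)"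
      by (simp add: inner_diff_left[of "\<eta> *\<^sub>R G"])
    ultimately show ?thesis
      using descent momentum unfolding next_v C_def by linarith
  qed
  have card: "real (card I) > 0"
    using I by (simp add: card_gt_0_iff)
  have "(\<Sum>i\<in>I. (\<eta> *\<^sub>R G - \<theta> *\<^sub>R (z - u)) \<bullet> D i) = real (card I) * ((\<eta> *\<^sub>R G - \<theta> *\<^sub>R (z - u)) \<bullet> G)"
    by (simp add: inner_sum_right[symmetric] mean)
  moreover have "(\<eta> *\<^sub>R G - \<theta> *\<^sub>R (z - u)) \<bullet> G = \<eta> * (norm G)\<^sup>2 - \<theta> * ((z - u) \<bullet> G)"
    by (simp add: inner_diff_left[of "\<eta> *\<^sub>R G"] power2_norm_eq_inner)
  ultimately have "(\<Sum>i\<in>I. C - \<eta> * (norm G)\<^sup>2 + (\<eta> *\<^sub>R G - \<theta> *\<^sub>R (z - u)) \<bullet> D i + \<eta> * (norm (D i - G))\<^sup>2)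
       = real (card I) * (C - \<theta> * ((z - u) \<bullet> G)) + \<eta> * (\<Sum>i\<in>I. (norm (D i - G))\<^sup>2)"
    by (simp only: sum.distrib sum_constant sum_distrib_left) (simp add: algebra_simps)
  also have "\<dots> / real (card I)
       = C - \<theta> * ((z - u) \<bullet> G) + \<eta> * ((\<Sum>i\<in>I. (norm (D i - G))\<^sup>2) / real (card I))"
    using card by (simp add: field_simps)
  also have "\<dots> \<le> C - \<theta> * ((z - u) \<bullet> G) + \<eta> * \<sigma>\<^sup>2"
    using mult_left_mono[OF var, of \<eta>] \<eta>(1) by linarith
  finally have averaged: "(\<Sum>i\<in>I. C - \<eta> * (norm G)\<^sup>2 + (\<eta> *\<^sub>R G - \<theta> *\<^sub>R (z - u)) \<bullet> D i
       + \<eta> * (norm (D i - G))\<^sup>2) / real (card I) \<le> C - \<theta> * ((z - u) \<bullet> G) + \<eta> * \<sigma>\<^sup>2" .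
  have jensen: "(norm (z - u))\<^sup>2 \<le> (1 - \<theta>) * (norm (v - u))\<^sup>2 + \<theta> * (norm (y - u))\<^sup>2"
  proof -
    have "(1 - \<theta>) * (norm (v - u))\<^sup>2 + \<theta> * (norm (y - u))\<^sup>2 - (norm (z - u))\<^sup>2
        = \<theta> * (1 - \<theta>) * (norm (v - y))\<^sup>2"
      unfolding z_def power2_norm_eq_inner by (simp add: inner_diff inner_add inner_commute algebra_simps)
    also have "\<dots> \<ge> 0"
      using \<theta> by simp
    finally show ?thesis by simp
  qed
  \<comment> \<open>The lower model at the old iterate and at the reference point, with weights
    \<open>1 - \<theta>\<close> and \<open>\<theta>\<close>; the choice of \<open>y\<close> makes the
    linear terms cancel the one left over from the momentum update.\<close>
  have "(1 - \<theta>) * (f y + G \<bullet> (x - y)) \<le> (1 - \<theta>) * f x"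
  proof (intro mult_left_mono)
    have "0 \<le> \<mu> / 2 * (norm (x - y))\<^sup>2" using \<mu> by simp
    then show "f y + G \<bullet> (x - y) \<le> f x" using lower[of x] by linarith
  qed (use \<theta> in auto)
  moreover have "\<theta> * (f y + G \<bullet> (u - y) + \<mu> / 2 * (norm (y - u))\<^sup>2) \<le> \<theta> * f u"
    using lower[of u] \<theta> by (intro mult_left_mono) (auto simp: norm_minus_commute)
  moreover have "G \<bullet> (\<theta> *\<^sub>R z) = G \<bullet> (y - (1 - \<theta>) *\<^sub>R x)"
    using \<theta>z by simp
  then have "(1 - \<theta>) * (G \<bullet> (x - y)) + \<theta> * (G \<bullet> (u - y)) = - \<theta> * ((z - u) \<bullet> G)"
    by (simp add: inner_diff inner_commute algebra_simps)
  moreover have "\<mu> / 2 * (norm (z - u))\<^sup>2 \<le> \<mu> / 2 * ((1 - \<theta>) * (norm (v - u))\<^sup>2 + \<theta> * (norm (y - u))\<^sup>2)"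
    using \<mu> jensen by (intro mult_left_mono) auto
  ultimately have "C - \<theta> * ((z - u) \<bullet> G) \<le> (1 - \<theta>) * (f x - f u + \<mu> / 2 * (norm (v - u))\<^sup>2)"
    unfolding C_def by (simp add: algebra_simps diff_divide_distrib add_divide_distrib inner_commute)
  moreover have "(\<Sum>i\<in>I. f (y - \<eta> *\<^sub>R D i) - f u
            + \<mu> / 2 * (norm (x + (1 / \<theta>) *\<^sub>R (y - \<eta> *\<^sub>R D i - x) - u))\<^sup>2) / real (card I)
      \<le> (\<Sum>i\<in>I. C - \<eta> * (norm G)\<^sup>2 + (\<eta> *\<^sub>R G - \<theta> *\<^sub>R (z - u)) \<bullet> D i
          + \<eta> * (norm (D i - G))\<^sup>2) / real (card I)"
    using each by (intro divide_right_mono sum_mono) auto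
  ultimately show ?thesis
    using averaged by linarith
qed

section \<open>Independent uniform index draws\<close>

locale uniform_index_draws = prob_space M for M :: "'w measure" +
  fixes idx :: "nat \<Rightarrow> 'w \<Rightarrow> nat" and n T :: nat
  assumes n: "n \<ge> 1"
    and indep: "indep_vars (\<lambda>_. count_space UNIV) idx {1..T}"
    and uniform: "\<And>k. k \<in> {1..T} \<Longrightarrow>
           distr M (count_space UNIV) (idx k) = measure_pmf (pmf_of_set {1..n})"
begin

text \<open>The indices drawn before step \<open>k\<close>, made extensional so that it takes values in a
  finite product of discrete spaces: every function of it is then measurable.\<close>

definition past :: "nat \<Rightarrow> 'w \<Rightarrow> nat \<Rightarrow> nat" where
  "past k \<omega> = restrict (\<lambda>j. idx j \<omega>) {1..<k}"

lemma idx_measurable: "k \<in> {1..T} \<Longrightarrow> idx k \<in> measurable M (count_space UNIV)"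
  using indep unfolding indep_vars_def by auto

lemma PiM_indices: "PiM {1..<k} (\<lambda>_. count_space (UNIV :: nat set)) = count_space (PiE {1..<k} (\<lambda>_::nat. UNIV))"
  by (rule count_space_PiM_finite) auto

lemma past_measurable:
  assumes "k \<le> T + 1"
  shows "past k \<in> measurable M (count_space (PiE {1..<k} (\<lambda>_. UNIV)))"
  unfolding past_def[abs_def] PiM_indices[symmetric]
  by (rule measurable_restrict) (use assms idx_measurable in auto)

lemma function_of_past_measurable:
  assumes "k \<le> T + 1"
  shows "(\<lambda>\<omega>. h (past k \<omega>) :: real) \<in> borel_measurable M"
  using measurable_compose[OF past_measurable[OF assms], of h borel] by simp

lemma AE_idx_in_range:
  assumes "k \<in> {1..T}"
  shows "AE \<omega> in M. idx k \<omega> \<in> {1..n}"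
proof -
  have "AE i in distr M (count_space UNIV) (idx k). i \<in> {1..n}"
    unfolding uniform[OF assms] using n by (simp add: AE_measure_pmf_iff)
  then show ?thesis
    using idx_measurable[OF assms] by (simp add: AE_distr_iff)
qed

text \<open>Almost surely the past takes one of finitely many values, so any function of it is
  essentially bounded.\<close>

lemma function_of_past_integrable:
  assumes "k \<le> T + 1"
  shows "integrable M (\<lambda>\<omega>. h (past k \<omega>) :: real)"
proof (rule integrable_const_bound)
  let ?S = "PiE {1..<k} (\<lambda>_. {1..n})"
  have "AE \<omega> in M. \<forall>j\<in>{1..<k}. idx j \<omega> \<in> {1..n}"
    using assms by (intro AE_finite_allI AE_idx_in_range) auto
  then show "AE \<omega> in M. norm (h (past k \<omega>)) \<le> (\<Sum>s\<in>?S. norm (h s))"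
  proof (rule AE_mp, intro AE_I2 impI)
    fix \<omega> assume "\<forall>j\<in>{1..<k}. idx j \<omega> \<in> {1..n}"
    then have "past k \<omega> \<in> ?S"
      by (auto simp: past_def)
    then show "norm (h (past k \<omega>)) \<le> (\<Sum>s\<in>?S. norm (h s))"
      by (intro member_le_sum) (auto intro!: finite_PiE)
  qed
qed (rule function_of_past_measurable[OF assms])

lemma function_of_past_and_present_integrable:
  assumes "k \<in> {1..T}"
  shows "integrable M (\<lambda>\<omega>. \<Phi> (past k \<omega>) (idx k \<omega>) :: real)"
proof -
  have "\<Phi> (past k \<omega>) (idx k \<omega>) = (\<lambda>s. \<Phi> (restrict s {1..<k}) (s k)) (past (k + 1) \<omega>)" for \<omega>
    using assms by (auto simp: past_def intro!: arg_cong2[where f = \<Phi>])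
  then show ?thesis
    using function_of_past_integrable[of "k + 1" "\<lambda>s. \<Phi> (restrict s {1..<k}) (s k)"] assms by simp
qed

lemma expectation_idx_eq:
  assumes "k \<in> {1..T}" "i \<in> {1..n}"
  shows "expectation (\<lambda>\<omega>. of_bool (idx k \<omega> = i)) = 1 / real n"
proof -
  have "expectation (\<lambda>\<omega>. of_bool (idx k \<omega> = i) :: real)
      = (\<integral>j. of_bool (j = i) \<partial>distr M (count_space UNIV) (idx k))"
    using idx_measurable[OF assms(1)] by (simp add: integral_distr)
  also have "\<dots> = (\<Sum>j\<in>{1..n}. of_bool (j = i)) / real n"
    unfolding uniform[OF assms(1)] using n by (subst integral_pmf_of_set) auto
  also have "\<dots> = 1 / real n"
    using assms(2) by (simp add: of_bool_def sum.delta)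
  finally show ?thesis .
qed

text \<open>The conditional expectation given the past, in integrated form: decompose according to
  the value of the current index and use its independence of the past.\<close>

lemma expectation_average_over_draw:
  assumes k: "k \<in> {1..T}"
  shows "expectation (\<lambda>\<omega>. \<Phi> (past k \<omega>) (idx k \<omega>))
       = expectation (\<lambda>\<omega>. (\<Sum>i=1..n. \<Phi> (past k \<omega>) i) / real n :: real)"
proof -
  have kT: "k \<le> T + 1" using k by simp
  have split: "expectation (\<lambda>\<omega>. \<Phi> (past k \<omega>) i * of_bool (idx k \<omega> = i))
      = expectation (\<lambda>\<omega>. \<Phi> (past k \<omega>) i) * (1 / real n)" if i: "i \<in> {1..n}" for i
  proof -
    have "indep_var (PiM {1..<k} (\<lambda>_. count_space UNIV)) (\<lambda>\<omega>. restrict (\<lambda>j. idx j \<omega>) {1..<k})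
            (PiM {k} (\<lambda>_. count_space UNIV)) (\<lambda>\<omega>. restrict (\<lambda>j. idx j \<omega>) {k})"
      using k by (intro indep_var_restrict[OF indep]) auto
    then have "indep_var borel ((\<lambda>s. \<Phi> s i) \<circ> (\<lambda>\<omega>. restrict (\<lambda>j. idx j \<omega>) {1..<k}))
            borel ((\<lambda>s. of_bool (s k = i) :: real) \<circ> (\<lambda>\<omega>. restrict (\<lambda>j. idx j \<omega>) {k}))"
    proof (rule indep_var_compose)
      show "(\<lambda>s. \<Phi> s i) \<in> borel_measurable (PiM {1..<k} (\<lambda>_. count_space UNIV))"
        unfolding PiM_indices by simp
      have "(\<lambda>s. s k) \<in> measurable (PiM {k} (\<lambda>_. count_space (UNIV :: nat set))) (count_space UNIV)"
        by (rule measurable_component_singleton) simp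
      then show "(\<lambda>s. of_bool (s k = i) :: real) \<in> borel_measurable (PiM {k} (\<lambda>_. count_space UNIV))"
        by (rule measurable_compose) simp
    qed
    then have "indep_var borel (\<lambda>\<omega>. \<Phi> (past k \<omega>) i) borel (\<lambda>\<omega>. of_bool (idx k \<omega> = i) :: real)"
      by (simp add: comp_def past_def)
    then show ?thesis
      using function_of_past_integrable[OF kT]
        function_of_past_and_present_integrable[OF k, of "\<lambda>_ j. of_bool (j = i)"]
      by (subst indep_var_lebesgue_integral) (auto simp: expectation_idx_eq[OF k i])
  qed
  have "expectation (\<lambda>\<omega>. \<Phi> (past k \<omega>) (idx k \<omega>))
      = expectation (\<lambda>\<omega>. \<Sum>i=1..n. \<Phi> (past k \<omega>) i * of_bool (idx k \<omega> = i))"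
  proof (rule integral_cong_AE)
    show "AE \<omega> in M. \<Phi> (past k \<omega>) (idx k \<omega>) = (\<Sum>i=1..n. \<Phi> (past k \<omega>) i * of_bool (idx k \<omega> = i))"
      using AE_idx_in_range[OF k] by (rule AE_mp) (auto simp: of_bool_def if_distrib cong: if_cong)
    show "(\<lambda>\<omega>. \<Sum>i=1..n. \<Phi> (past k \<omega>) i * of_bool (idx k \<omega> = i)) \<in> borel_measurable M"
      using function_of_past_and_present_integrable[OF k, of "\<lambda>s j. \<Sum>i=1..n. \<Phi> s i * of_bool (j = i)"]
      by (rule borel_measurable_integrable)
    show "(\<lambda>\<omega>. \<Phi> (past k \<omega>) (idx k \<omega>)) \<in> borel_measurable M"
      using function_of_past_and_present_integrable[OF k] by (rule borel_measurable_integrable)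
  qed
  also have "\<dots> = (\<Sum>i=1..n. expectation (\<lambda>\<omega>. \<Phi> (past k \<omega>) i * of_bool (idx k \<omega> = i)))"
    by (intro Bochner_Integration.integral_sum
        function_of_past_and_present_integrable[OF k, of "\<lambda>s j. \<Phi> s _ * of_bool (j = _)"])
  also have "\<dots> = (\<Sum>i=1..n. expectation (\<lambda>\<omega>. \<Phi> (past k \<omega>) i) * (1 / real n))"
    by (intro sum.cong refl split)
  also have "\<dots> = expectation (\<lambda>\<omega>. (\<Sum>i=1..n. \<Phi> (past k \<omega>) i) / real n)"
  proof -
    have "integrable M (\<lambda>\<omega>. \<Phi> (past k \<omega>) i)" for i
      using kT by (rule function_of_past_integrable)
    then show ?thesis
      by (simp add: Bochner_Integration.integral_sum sum_divide_distrib[symmetric])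
  qed
  finally show ?thesis .
qed

lemma recursive_state_function_of_past:
  assumes init: "\<And>\<omega>. \<omega> \<in> space M \<Longrightarrow> s 1 \<omega> = s\<^sub>1"
    and rec: "\<And>k \<omega>. k \<in> {1..T} \<Longrightarrow> \<omega> \<in> space M \<Longrightarrow> s (k + 1) \<omega> = step k (s k \<omega>) (idx k \<omega>)"
    and k: "1 \<le> k" "k \<le> T + 1"
  shows "\<exists>F. \<forall>\<omega>\<in>space M. s k \<omega> = F (past k \<omega>)"
  using k
proof (induction k rule: nat_induct_at_least)
  case base
  then show ?case using init by auto
next
  case (Suc k)
  then obtain F where F: "\<And>\<omega>. \<omega> \<in> space M \<Longrightarrow> s k \<omega> = F (past k \<omega>)" by auto
  have "s (Suc k) \<omega> = (\<lambda>p. step k (F (restrict p {1..<k})) (p k)) (past (Suc k) \<omega>)" if \<omega>: "\<omega> \<in> space M" for \<omega>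
  proof -
    have past_Suc: "restrict (past (Suc k) \<omega>) {1..<k} = past k \<omega>" "past (Suc k) \<omega> k = idx k \<omega>"
      using Suc.hyps by (auto simp: past_def)
    have "k \<in> {1..T}"
      using Suc.hyps Suc.prems by simp
    then have "s (Suc k) \<omega> = step k (F (past k \<omega>)) (idx k \<omega>)"
      using rec[of k \<omega>] \<omega> by (simp add: F[OF \<omega>])
    then show ?thesis
      by (simp only: past_Suc)
  qed
  then show ?case
    by (intro exI ballI)
qed

text \<open>A drift inequality for the average over all indices at a fixed state becomes an
  inequality between expectations. Measurability and integrability are automatic, because the
  state is almost surely one of finitely many values.\<close>

lemma expected_potential_step:
  fixes \<Psi> :: "'s \<Rightarrow> real"
  assumes init: "\<And>\<omega>. \<omega> \<in> space M \<Longrightarrow> s 1 \<omega> = s\<^sub>1"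
    and rec: "\<And>k \<omega>. k \<in> {1..T} \<Longrightarrow> \<omega> \<in> space M \<Longrightarrow> s (k + 1) \<omega> = step k (s k \<omega>) (idx k \<omega>)"
    and drift: "\<And>x. (\<Sum>i=1..n. \<Psi> (step k x i)) / real n \<le> q * \<Psi> x + e"
    and k: "k \<in> {1..T}"
  shows "expectation (\<lambda>\<omega>. \<Psi> (s (k + 1) \<omega>)) \<le> q * expectation (\<lambda>\<omega>. \<Psi> (s k \<omega>)) + e"
proof -
  have kT: "1 \<le> k" "k \<le> T + 1" using k by auto
  obtain F where F: "\<And>\<omega>. \<omega> \<in> space M \<Longrightarrow> s k \<omega> = F (past k \<omega>)"
    using recursive_state_function_of_past[where s = s and step = step and s\<^sub>1 = s\<^sub>1, OF init rec kT] by blast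
  have "expectation (\<lambda>\<omega>. \<Psi> (s (k + 1) \<omega>)) = expectation (\<lambda>\<omega>. \<Psi> (step k (F (past k \<omega>)) (idx k \<omega>)))"
    using rec[OF k] F by (intro Bochner_Integration.integral_cong) auto
  also have "\<dots> = expectation (\<lambda>\<omega>. (\<Sum>i=1..n. \<Psi> (step k (F (past k \<omega>)) i)) / real n)"
    using k by (rule expectation_average_over_draw)
  also have "\<dots> \<le> expectation (\<lambda>\<omega>. q * \<Psi> (F (past k \<omega>)) + e)"
    using function_of_past_integrable[OF kT(2), of "\<lambda>p. (\<Sum>i=1..n. \<Psi> (step k (F p) i)) / real n"]
      function_of_past_integrable[OF kT(2), of "\<lambda>p. q * \<Psi> (F p) + e"] drift
    by (rule integral_mono)
  also have "\<dots> = q * expectation (\<lambda>\<omega>. \<Psi> (F (past k \<omega>))) + e"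
    using function_of_past_integrable[OF kT(2), of "\<lambda>p. \<Psi> (F p)"]
    by (simp add: prob_space)
  also have "expectation (\<lambda>\<omega>. \<Psi> (F (past k \<omega>))) = expectation (\<lambda>\<omega>. \<Psi> (s k \<omega>))"
    using F by (intro Bochner_Integration.integral_cong) auto
  finally show ?thesis .
qed

lemma recursive_state_integrable:
  fixes \<Psi> :: "'s \<Rightarrow> real"
  assumes init: "\<And>\<omega>. \<omega> \<in> space M \<Longrightarrow> s 1 \<omega> = s\<^sub>1"
    and rec: "\<And>k \<omega>. k \<in> {1..T} \<Longrightarrow> \<omega> \<in> space M \<Longrightarrow> s (k + 1) \<omega> = step k (s k \<omega>) (idx k \<omega>)"
    and k: "1 \<le> k" "k \<le> T + 1"
  shows "integrable M (\<lambda>\<omega>. \<Psi> (s k \<omega>))"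
proof -
  obtain F where F: "\<And>\<omega>. \<omega> \<in> space M \<Longrightarrow> s k \<omega> = F (past k \<omega>)"
    using recursive_state_function_of_past[where s = s and step = step and s\<^sub>1 = s\<^sub>1, OF init rec k] by blast
  have "integrable M (\<lambda>\<omega>. \<Psi> (F (past k \<omega>)))"
    using k(2) by (rule function_of_past_integrable)
  moreover have "integrable M (\<lambda>\<omega>. \<Psi> (s k \<omega>)) \<longleftrightarrow> integrable M (\<lambda>\<omega>. \<Psi> (F (past k \<omega>)))"
    using F by (intro Bochner_Integration.integrable_cong) auto
  ultimately show ?thesis by simp
qed

end

section \<open>Contraction along a geometric schedule\<close>

text \<open>Bounding the factors by exponentials first turns the products of the unrolled recursion into
  exponentials of sums; this step relies on the nonnegativity of the sequence.\<close>

lemma unroll_contraction: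
  fixes a \<theta> e :: "nat \<Rightarrow> real"
  assumes rec: "\<And>k. k \<in> {1..T} \<Longrightarrow> a (k + 1) \<le> (1 - \<theta> k) * a k + e k"
    and nonneg: "\<And>k. k \<in> {1..T} \<Longrightarrow> 0 \<le> a k" and m: "m \<le> T"
  shows "a (m + 1) \<le> exp (- (\<Sum>i=1..m. \<theta> i)) * a 1 + (\<Sum>k=1..m. e k * exp (- (\<Sum>i=k+1..m. \<theta> i)))"
  using m
proof (induction m)
  case 0
  then show ?case by simp
next
  case (Suc m)
  let ?q = "exp (- \<theta> (Suc m))"
  let ?B = "exp (- (\<Sum>i=1..m. \<theta> i)) * a 1 + (\<Sum>k=1..m. e k * exp (- (\<Sum>i=k+1..m. \<theta> i)))"
  have "a (Suc m + 1) \<le> (1 - \<theta> (Suc m)) * a (Suc m) + e (Suc m)"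
    using rec[of "Suc m"] Suc.prems by simp
  also have "(1 - \<theta> (Suc m)) * a (Suc m) \<le> ?q * a (Suc m)"
    using nonneg[of "Suc m"] Suc.prems exp_ge_add_one_self[of "- \<theta> (Suc m)"] by (intro mult_right_mono) auto
  also have "\<dots> \<le> ?q * ?B"
    using Suc by (intro mult_left_mono) auto
  also have "?q * ?B = exp (- (\<Sum>i=1..Suc m. \<theta> i)) * a 1 + (\<Sum>k=1..m. e k * exp (- (\<Sum>i=k+1..Suc m. \<theta> i)))"
  proof -
    have "?q * exp (- (\<Sum>i=k+1..m. \<theta> i)) = exp (- (\<Sum>i=k+1..Suc m. \<theta> i))" if "k \<le> m" for k
      using that by (simp add: exp_add[symmetric] sum.cl_ivl_Suc)
    from this[of 0] this show ?thesis
      by (simp add: distrib_left sum_distrib_left mult.left_commute mult.assoc[symmetric])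
  qed
  finally show ?case by simp
qed

text \<open>The constant is sharp: the product of the squared argument and the exponential is largest at $2$.\<close>

lemma exp_minus_le_inverse_square:
  fixes x :: real
  assumes "x > 0"
  shows "exp (- x) \<le> 4 / ((exp 1)\<^sup>2 * x\<^sup>2)"
proof -
  have "x / 2 \<le> exp (x / 2 - 1)"
    using exp_ge_add_one_self[of "x / 2 - 1"] by simp
  then have "exp 1 * (x / 2) \<le> exp 1 * exp (x / 2 - 1)"
    by (intro mult_left_mono) auto
  then have "exp 1 * (x / 2) \<le> exp (x / 2)"
    by (simp add: exp_add[symmetric])
  then have "(exp 1 * (x / 2))\<^sup>2 \<le> (exp (x / 2))\<^sup>2"
    using assms by (intro power_mono) auto
  also have "(exp (x / 2))\<^sup>2 = exp x"
    by (simp add: exp_double[symmetric])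
  finally show ?thesis
    using assms by (simp add: exp_minus field_simps power_mult_distrib)
qed

locale geometric_schedule =
  fixes \<alpha> \<beta> :: real and T :: nat
  assumes \<beta>: "0 < \<beta>" "\<beta> < real T"
    and \<alpha>: "\<alpha> = (\<beta> / real T) powr (1 / real T)"
begin

lemma T_pos: "real T > 0" and ln_pos: "ln (real T / \<beta>) > 0"
  using \<beta> by (auto simp: ln_gt_zero_iff)

lemma power_eq_powr: "\<alpha> ^ k = (\<beta> / real T) powr (real k / real T)"
  using \<beta> by (simp add: \<alpha> powr_realpow[symmetric] powr_powr)

lemma ratio_pos: "0 < \<alpha>"
  using \<beta> by (simp add: \<alpha>)

lemma power_T: "\<alpha> ^ T = \<beta> / real T"
  using \<beta> by (simp add: power_eq_powr)

lemma ln_ratio: "ln \<alpha> = - (ln (real T / \<beta>) / real T)"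
  using \<beta> by (simp add: \<alpha> ln_powr ln_div field_simps)

lemma ratio_less_1: "\<alpha> < 1"
  using ln_ratio ln_pos T_pos ratio_pos by (metis divide_pos_pos ln_less_zero_iff neg_less_0_iff_less)

lemma one_minus_ratio_upper: "1 - \<alpha> \<le> ln (real T / \<beta>) / real T"
  using ln_le_minus_one[OF ratio_pos] ln_ratio by linarith

lemma one_minus_ratio_lower: "\<alpha> * (ln (real T / \<beta>) / real T) \<le> 1 - \<alpha>"
proof -
  have "ln (inverse \<alpha>) \<le> inverse \<alpha> - 1"
    using ratio_pos by (intro ln_le_minus_one) simp
  then have "ln (real T / \<beta>) / real T \<le> inverse \<alpha> - 1"
    using ln_ratio ratio_pos by (simp add: ln_inverse)
  then have "\<alpha> * (ln (real T / \<beta>) / real T) \<le> \<alpha> * (inverse \<alpha> - 1)"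
    using ratio_pos by (intro mult_left_mono) auto
  then show ?thesis
    using ratio_pos by (simp add: algebra_simps)
qed

text \<open>The missing end of the geometric series is
  $\alpha^{T+1}/(1-\alpha) = (\beta/T)\,\alpha/(1-\alpha) \le \beta/l$
  with $l = \ln(T/\beta)$; its contribution is moved into the first factor.\<close>

lemma tail_decay:
  assumes "c > 0" "k \<le> T"
  shows "exp (- (\<Sum>i=k+1..T. c * \<alpha> ^ i))
      \<le> exp (2 * \<beta> * c / ln (real T / \<beta>)) * exp (- (c * \<alpha> ^ (k + 1) / (1 - \<alpha>)))"
proof -
  have "(1 - \<alpha>) * (\<Sum>i=k+1..T. \<alpha> ^ i) = \<alpha> ^ (k + 1) - \<alpha> ^ Suc T"
    using assms sum_gp_multiplied[of "k + 1" T \<alpha>] by (cases "k = T") auto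
  then have "(\<Sum>i=k+1..T. \<alpha> ^ i) = \<alpha> ^ (k + 1) / (1 - \<alpha>) - \<alpha> ^ Suc T / (1 - \<alpha>)"
    using ratio_less_1 by (simp only: diff_divide_distrib[symmetric] eq_divide_eq mult.commute) auto
  then have *: "(\<Sum>i=k+1..T. c * \<alpha> ^ i) = c * \<alpha> ^ (k + 1) / (1 - \<alpha>) - c * (\<alpha> ^ Suc T / (1 - \<alpha>))"
    by (simp add: sum_distrib_left[symmetric] right_diff_distrib)
  have "\<alpha> ^ Suc T / (1 - \<alpha>) = \<beta> / real T * (\<alpha> / (1 - \<alpha>))"
    by (simp add: power_T)
  also have "\<dots> \<le> \<beta> / real T * (real T / ln (real T / \<beta>))"
  proof (intro mult_left_mono)
    show "\<alpha> / (1 - \<alpha>) \<le> real T / ln (real T / \<beta>)"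
      using one_minus_ratio_lower ratio_less_1 ln_pos T_pos by (simp add: field_simps)
  qed (use \<beta> in auto)
  also have "\<dots> \<le> 2 * \<beta> / ln (real T / \<beta>)"
    using T_pos ln_pos \<beta> by (simp add: field_simps)
  finally have "c * (\<alpha> ^ Suc T / (1 - \<alpha>)) \<le> c * (2 * \<beta> / ln (real T / \<beta>))"
    using assms by (intro mult_left_mono) auto
  then show ?thesis
    unfolding * exp_add[symmetric] by (simp add: mult_ac)
qed

lemma total_decay:
  assumes "c > 0"
  shows "exp (- (\<Sum>i=1..T. c * \<alpha> ^ i))
      \<le> exp (2 * \<beta> * c / ln (real T / \<beta>)) * exp (- (real T * c) * (\<alpha> / ln (real T / \<beta>)))"
proof -
  have "real T / ln (real T / \<beta>) \<le> 1 / (1 - \<alpha>)"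
    using one_minus_ratio_upper ratio_less_1 ln_pos T_pos by (simp add: field_simps)
  then have "c * \<alpha> * (real T / ln (real T / \<beta>)) \<le> c * \<alpha> * (1 / (1 - \<alpha>))"
    using assms ratio_pos by (intro mult_left_mono) auto
  then have decay: "exp (- (c * \<alpha> / (1 - \<alpha>))) \<le> exp (- (real T * c) * (\<alpha> / ln (real T / \<beta>)))"
    by (simp add: mult_ac)
  have "exp (- (\<Sum>i=1..T. c * \<alpha> ^ i))
      \<le> exp (2 * \<beta> * c / ln (real T / \<beta>)) * exp (- (c * \<alpha> / (1 - \<alpha>)))"
    using tail_decay[OF assms, of 0] by simp
  also have "\<dots> \<le> exp (2 * \<beta> * c / ln (real T / \<beta>)) * exp (- (real T * c) * (\<alpha> / ln (real T / \<beta>)))"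
    using decay by (rule mult_left_mono) simp
  finally show ?thesis .
qed

text \<open>By the inverse square bound each summand is at most a constant times
  $(1-\alpha)^2/(c\,\alpha)^2$, uniformly in $k$, because the powers $\alpha^{2k}$ cancel.\<close>

lemma noise_sum:
  assumes "c > 0"
  shows "(\<Sum>k=1..T. (\<alpha> ^ k)\<^sup>2 * exp (- (\<Sum>i=k+1..T. c * \<alpha> ^ i)))
      \<le> exp (2 * \<beta> * c / ln (real T / \<beta>)) * 4 / (c\<^sup>2 * (exp 1)\<^sup>2)
         * ((ln (real T / \<beta>))\<^sup>2 / (\<alpha>\<^sup>2 * real T))"
proof -
  let ?K = "exp (2 * \<beta> * c / ln (real T / \<beta>))"
  let ?l = "ln (real T / \<beta>)"
  have "(\<alpha> ^ k)\<^sup>2 * exp (- (\<Sum>i=k+1..T. c * \<alpha> ^ i)) \<le> ?K * 4 / (c\<^sup>2 * (exp 1)\<^sup>2) * ((?l / real T)\<^sup>2 / \<alpha>\<^sup>2)"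
    if k: "k \<in> {1..T}" for k
  proof -
    have "exp (- (c * \<alpha> ^ (k + 1) / (1 - \<alpha>))) \<le> 4 / ((exp 1)\<^sup>2 * (c * \<alpha> ^ (k + 1) / (1 - \<alpha>))\<^sup>2)"
      using assms ratio_pos ratio_less_1 by (intro exp_minus_le_inverse_square) simp
    then have "?K * exp (- (c * \<alpha> ^ (k + 1) / (1 - \<alpha>)))
        \<le> ?K * (4 / ((exp 1)\<^sup>2 * (c * \<alpha> ^ (k + 1) / (1 - \<alpha>))\<^sup>2))"
      by (intro mult_left_mono) auto
    moreover have "exp (- (\<Sum>i=k+1..T. c * \<alpha> ^ i)) \<le> ?K * exp (- (c * \<alpha> ^ (k + 1) / (1 - \<alpha>)))"
      using k by (intro tail_decay assms) auto
    ultimately have "(\<alpha> ^ k)\<^sup>2 * exp (- (\<Sum>i=k+1..T. c * \<alpha> ^ i))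
       \<le> (\<alpha> ^ k)\<^sup>2 * (?K * (4 / ((exp 1)\<^sup>2 * (c * \<alpha> ^ (k + 1) / (1 - \<alpha>))\<^sup>2)))"
      by (intro mult_left_mono) auto
    also have "\<dots> = ?K * 4 / (c\<^sup>2 * (exp 1)\<^sup>2) * ((1 - \<alpha>)\<^sup>2 / \<alpha>\<^sup>2)"
      using assms ratio_pos ratio_less_1 by (simp add: power_mult_distrib power_divide, simp add: mult_ac)
    also have "\<dots> \<le> ?K * 4 / (c\<^sup>2 * (exp 1)\<^sup>2) * ((?l / real T)\<^sup>2 / \<alpha>\<^sup>2)"
      using one_minus_ratio_upper ratio_less_1
      by (intro mult_left_mono divide_right_mono power_mono) auto
    finally show ?thesis .
  qed
  then have "(\<Sum>k=1..T. (\<alpha> ^ k)\<^sup>2 * exp (- (\<Sum>i=k+1..T. c * \<alpha> ^ i)))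
      \<le> real (card {1..T}) * (?K * 4 / (c\<^sup>2 * (exp 1)\<^sup>2) * ((?l / real T)\<^sup>2 / \<alpha>\<^sup>2))"
    by (rule sum_bounded_above)
  also have "\<dots> = ?K * 4 / (c\<^sup>2 * (exp 1)\<^sup>2) * (?l\<^sup>2 / (\<alpha>\<^sup>2 * real T))"
    using T_pos by (simp add: power_divide power2_eq_square, simp add: mult_ac)
  finally show ?thesis .
qed

end

section \<open>Convergence of accelerated stochastic gradient descent\<close>

theorem theorem6:
  fixes fs :: "nat \<Rightarrow> real ^ 'd \<Rightarrow> real" and f :: "real ^ 'd \<Rightarrow> real"
    and Ls :: "nat \<Rightarrow> real" and L \<mu> \<kappa> \<sigma> \<beta> \<alpha> c\<^sub>3 fstar :: real and n T :: nat
    and \<gamma> \<alpha>s r b \<Delta> :: "nat \<Rightarrow> real"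
    and M :: "'w measure" and idx :: "nat \<Rightarrow> 'w \<Rightarrow> nat"
    and w y :: "nat \<Rightarrow> 'w \<Rightarrow> real ^ 'd" and x\<^sub>1 :: "real ^ 'd"
  assumes "n \<ge> 1"
    and "\<And>i v. i \<in> {1..n} \<Longrightarrow> fs i differentiable (at v)"
    and "\<And>i. i \<in> {1..n} \<Longrightarrow> bdd_below (range (fs i))"
    and "\<And>i. i \<in> {1..n} \<Longrightarrow> convex_on UNIV (fs i)"
    and "\<And>i. i \<in> {1..n} \<Longrightarrow> smooth_with (Ls i) (fs i)"
    and "\<And>v. f v = 1 / real n * (\<Sum>i=1..n. fs i v)"
    and "strongly_convex_with \<mu> f"
    and "\<And>v. measure_pmf.expectation (pmf_of_set {1..n})
               (\<lambda>i. (norm (grad (fs i) v - grad f v))\<^sup>2) \<le> \<sigma>\<^sup>2"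
    and "L = Max (Ls ` {1..n})"
    and "\<kappa> = L / \<mu>"
    and "fstar = (LEAST m. m \<in> range f)"
    and "1 \<le> \<beta>" and "\<beta> < real T"
    and "\<alpha> = (\<beta> / real T) powr (1 / real T)"
    and "\<And>k. \<gamma> k = 1 / L"
    and "\<And>k. \<alpha>s k = (\<beta> / real T) powr (real k / real T)"
    and "\<And>k. r k = sqrt (\<mu> / L) * (\<beta> / real T) powr (real k / real T)"
    and "\<And>k. k \<ge> 2 \<Longrightarrow>
           b k = (1 - r (k - 1)) * r (k - 1) * \<alpha>\<^sup>2 / (r k + (r (k - 1))\<^sup>2 * \<alpha>\<^sup>2)"
    and "prob_space M"
    and "prob_space.indep_vars M (\<lambda>_. count_space UNIV) idx {1..T}"
    and "\<And>k. k \<in> {1..T} \<Longrightarrow>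
           distr M (count_space UNIV) (idx k) = measure_pmf (pmf_of_set {1..n})"
    and "\<And>\<omega>. \<omega> \<in> space M \<Longrightarrow> w 1 \<omega> = x\<^sub>1"
    and "\<And>\<omega>. \<omega> \<in> space M \<Longrightarrow> y 1 \<omega> = x\<^sub>1"
    and "\<And>k \<omega>. k \<in> {2..T} \<Longrightarrow> \<omega> \<in> space M \<Longrightarrow>
           y k \<omega> = w k \<omega> + b k *\<^sub>R (w k \<omega> - w (k - 1) \<omega>)"
    and "\<And>k \<omega>. k \<in> {1..T} \<Longrightarrow> \<omega> \<in> space M \<Longrightarrow>
           w (k + 1) \<omega> = y k \<omega> - (\<gamma> k * (\<alpha>s k)\<^sup>2) *\<^sub>R grad (fs (idx k \<omega>)) (y k \<omega>)"
    and "\<And>k. \<Delta> k = prob_space.expectation M (\<lambda>\<omega>. f (w k \<omega>) - fstar)"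
    and "c\<^sub>3 = exp (2 * \<beta> / (sqrt \<kappa> * ln (real T / \<beta>)))"
  shows "\<Delta> (T + 1)
    \<le> 2 * c\<^sub>3 * exp (- (real T / sqrt \<kappa>) * (\<alpha> / ln (real T / \<beta>))) * \<Delta> 1
      + 4 * \<sigma>\<^sup>2 * c\<^sub>3 / (\<mu> * (exp 1)\<^sup>2) * ((ln (real T / \<beta>))\<^sup>2 / (\<alpha>\<^sup>2 * real T))"
proof -
  note n = assms(1) and diff = assms(2) and fs_smooth = assms(5) and f_eq = assms(6)
    and strong = assms(7) and variance = assms(8) and L_eq = assms(9) and kappa_eq = assms(10)
    and fstar_eq = assms(11) and beta = assms(12,13) and alpha_eq = assms(14)
    and gamma_eq = assms(15) and alphas_eq = assms(16) and r_eq = assms(17) and b_eq = assms(18)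
    and w_init = assms(22) and y_init = assms(23) and y_rec = assms(24) and w_rec = assms(25)
    and Delta_eq = assms(26) and c3_eq = assms(27)
  interpret uniform_index_draws M idx n T
    by (rule uniform_index_draws.intro[OF assms(19) uniform_index_draws_axioms.intro[OF assms(1,20,21)]])
  interpret geometric_schedule \<alpha> \<beta> T
    by (rule geometric_schedule.intro) (use beta alpha_eq in auto)
  let ?l = "ln (real T / \<beta>)"
  define c where "c = sqrt (\<mu> / L)"
  have gradients: "GDERIV (fs i) v :> grad (fs i) v" if "i \<in> {1..n}" for i v
    using differentiable_imp_GDERIV_grad[OF diff[OF that]] .
  have f_avg: "f = (\<lambda>v. (1 / real n) * (\<Sum>i=1..n. fs i v))"
    using f_eq by blast
  have f_deriv: "GDERIV f v :> (1 / real n) *\<^sub>R (\<Sum>i=1..n. grad (fs i) v)" for v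
    unfolding f_avg by (intro GDERIV_scaled_sum gradients)
  then have f_grad: "grad f v = (1 / real n) *\<^sub>R (\<Sum>i=1..n. grad (fs i) v)" for v
    by (rule grad_eqI)
  have f_diff: "f differentiable (at v)" for v
    using f_deriv[of v] by (auto simp: gderiv_def differentiable_def)
  have f_upper: "f v \<le> f p + grad f p \<bullet> (v - p) + L / 2 * (norm (v - p))\<^sup>2" for v p
  proof -
    have "fs i v \<le> fs i p + grad (fs i) p \<bullet> (v - p) + L / 2 * (norm (v - p))\<^sup>2" if "i \<in> {1..n}" for i
    proof -
      have "Ls i \<le> L"
        unfolding L_eq using that by (intro Max_ge) auto
      then have "Ls i / 2 * (norm (v - p))\<^sup>2 \<le> L / 2 * (norm (v - p))\<^sup>2"
        by (intro mult_right_mono) auto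
      moreover have "fs i v \<le> fs i p + grad (fs i) p \<bullet> (v - p) + Ls i / 2 * (norm (v - p))\<^sup>2"
        using fs_smooth[OF that] unfolding smooth_with_def by blast
      ultimately show ?thesis by linarith
    qed
    then have "(\<Sum>i=1..n. fs i v) \<le> (\<Sum>i=1..n. fs i p + grad (fs i) p \<bullet> (v - p) + L / 2 * (norm (v - p))\<^sup>2)"
      by (rule sum_mono)
    then have "f v \<le> (1 / real n) * (\<Sum>i=1..n. fs i p + grad (fs i) p \<bullet> (v - p) + L / 2 * (norm (v - p))\<^sup>2)"
      unfolding f_eq[of v] by (intro mult_left_mono) auto
    also have "\<dots> = f p + grad f p \<bullet> (v - p) + L / 2 * (norm (v - p))\<^sup>2"
      using n unfolding f_grad f_eq[of p]
      by (simp only: sum.distrib inner_scaleR_left inner_sum_left) (simp add: field_simps)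
    finally show ?thesis .
  qed
  have mu: "\<mu> > 0" and f_lower: "f p + grad f p \<bullet> (v - p) + \<mu> / 2 * (norm (v - p))\<^sup>2 \<le> f v" for v p
    using strong unfolding strongly_convex_with_def by auto
  have mu_le: "\<mu> \<le> L"
    using strong f_upper by (intro strongly_convex_smooth_le[of \<mu> f]) (auto simp: smooth_with_def)
  then have L: "L > 0"
    using mu by linarith
  have c: "0 < c" "c \<le> 1" "c\<^sup>2 = \<mu> / L"
    using mu L mu_le by (auto simp: c_def)
  have c_kappa: "1 / sqrt \<kappa> = c"
    using mu L by (simp add: c_def kappa_eq real_sqrt_divide)
  obtain u where u_min: "\<And>v. f u \<le> f v" and growth: "\<And>v. f u + \<mu> / 2 * (norm (v - u))\<^sup>2 \<le> f v"
    using strongly_convex_minimiser[OF strong f_diff] by blast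
  have fstar: "fstar = f u"
    unfolding fstar_eq using u_min by (intro Least_equality) auto

  have r: "r k = c * \<alpha> ^ k" for k
    by (simp add: r_eq power_eq_powr c_def)
  have r_pos: "0 < r k" for k
    using c ratio_pos by (simp add: r)
  have r_le: "r k \<le> 1" for k
    unfolding r using c ratio_pos ratio_less_1 by (intro mult_le_one power_le_one) auto
  \<comment> \<open>Effective step sizes; the schedule satisfies \<open>(r k)\<^sup>2 = \<mu> * \<eta> k\<close>.\<close>
  define \<eta> where "\<eta> k = (\<alpha> ^ k)\<^sup>2 / L" for k
  have step_size: "\<gamma> k * (\<alpha>s k)\<^sup>2 = \<eta> k" for k
    by (simp add: gamma_eq alphas_eq power_eq_powr \<eta>_def)
  have eta: "0 < \<eta> k" "L * \<eta> k \<le> 1" "(r k)\<^sup>2 = \<mu> * \<eta> k" for k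
    using L c(3) ratio_pos ratio_less_1 by (auto simp: \<eta>_def r power_mult_distrib intro!: power_le_one)

  \<comment> \<open>The state is the pair of iterate and momentum point. The definitions below express one
    iteration as a map of this state and the drawn index; the momentum point is recovered from
    two successive iterates.\<close>
  define v where "v k \<omega> = (if k = 1 then x\<^sub>1 else
      w (k - 1) \<omega> + (1 / r (k - 1)) *\<^sub>R (w k \<omega> - w (k - 1) \<omega>))" for k \<omega>
  define Y where "Y k p = (1 / (1 + r k)) *\<^sub>R (r k *\<^sub>R snd p + fst p)" for k and p :: "(real ^ 'd) \<times> (real ^ 'd)"
  define X where "X k p i = Y k p - \<eta> k *\<^sub>R grad (fs i) (Y k p)" for k i and p :: "(real ^ 'd) \<times> (real ^ 'd)"
  define step where "step k p i = (X k p i, fst p + (1 / r k) *\<^sub>R (X k p i - fst p))"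
    for k i and p :: "(real ^ 'd) \<times> (real ^ 'd)"
  define s where "s k \<omega> = (w k \<omega>, v k \<omega>)" for k \<omega>
  define \<Psi> where "\<Psi> p = f (fst p) - f u + \<mu> / 2 * (norm (snd p - u))\<^sup>2" for p
  have s_init: "s 1 \<omega> = (x\<^sub>1, x\<^sub>1)" if "\<omega> \<in> space M" for \<omega>
    using w_init[OF that] by (simp add: s_def v_def)
  have Y_scaled: "(1 + r k) *\<^sub>R Y k p = r k *\<^sub>R snd p + fst p" for k p
    using r_pos[of k] by (simp add: Y_def)
  have y_from_state: "y k \<omega> = Y k (s k \<omega>)" if k: "k \<in> {1..T}" and \<omega>: "\<omega> \<in> space M" for k \<omega>
  proof -
    have "(1 + r k) *\<^sub>R y k \<omega> = r k *\<^sub>R v k \<omega> + w k \<omega>"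
    proof (cases "k = 1")
      case True
      then show ?thesis
        using w_init[OF \<omega>] y_init[OF \<omega>] by (simp add: v_def algebra_simps)
    next
      case False
      then have k2: "k \<in> {2..T}" "k \<ge> 2" using k by auto
      let ?q = "r (k - 1)"
      have q: "?q > 0" using r_pos .
      have rk: "r k = \<alpha> * ?q"
        using k2(2) by (cases k) (auto simp: r)
      \<comment> \<open>Since \<open>r k = \<alpha> * ?q\<close>, a factor \<open>\<alpha> * ?q\<close> cancels in the
        extrapolation coefficient, which leaves Nesterov's coefficient.\<close>
      have "r k + ?q\<^sup>2 * \<alpha>\<^sup>2 = \<alpha> * ?q * (1 + r k)"
        unfolding rk by (simp add: power2_eq_square algebra_simps)
      then have "b k = (\<alpha> * ?q) * (\<alpha> * (1 - ?q)) / ((\<alpha> * ?q) * (1 + r k))"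
        unfolding b_eq[OF k2(2)] by (simp add: power2_eq_square mult_ac)
      also have "\<dots> = \<alpha> * (1 - ?q) / (1 + r k)"
        using q ratio_pos by simp
      finally have "(1 + r k) * b k = \<alpha> * (1 - ?q)"
        using r_pos[of k] by simp
      also have "\<dots> = r k / ?q - r k"
        using q by (simp add: rk field_simps)
      finally have "(1 + r k) *\<^sub>R y k \<omega>
          = (1 + r k) *\<^sub>R w k \<omega> + (r k / ?q - r k) *\<^sub>R (w k \<omega> - w (k - 1) \<omega>)"
        unfolding y_rec[OF k2(1) \<omega>] by (simp add: scaleR_add_right)
      also have "\<dots> = r k *\<^sub>R v k \<omega> + w k \<omega>"
        using False by (simp add: v_def algebra_simps)
      finally show ?thesis .
    qed
    then have "(1 + r k) *\<^sub>R y k \<omega> = (1 + r k) *\<^sub>R Y k (s k \<omega>)"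
      by (simp add: Y_scaled s_def)
    then show ?thesis
      using r_pos[of k] by simp
  qed
  have s_rec: "s (k + 1) \<omega> = step k (s k \<omega>) (idx k \<omega>)" if "k \<in> {1..T}" "\<omega> \<in> space M" for k \<omega>
  proof -
    have "w (k + 1) \<omega> = X k (s k \<omega>) (idx k \<omega>)"
      unfolding w_rec[OF that] X_def y_from_state[OF that] step_size ..
    then show ?thesis
      using that(1) by (simp add: s_def step_def v_def)
  qed
  have drift: "(\<Sum>i=1..n. \<Psi> (step k p i)) / real n \<le> (1 - r k) * \<Psi> p + \<eta> k * \<sigma>\<^sup>2" for k p
  proof -
    have "(\<Sum>i=1..n. (norm (grad (fs i) (Y k p) - grad f (Y k p)))\<^sup>2) / real (card {1..n}) \<le> \<sigma>\<^sup>2"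
      using variance[of "Y k p"] n by (subst (asm) integral_pmf_of_set) auto
    moreover have "(\<Sum>i=1..n. grad (fs i) (Y k p)) = real (card {1..n}) *\<^sub>R grad f (Y k p)"
      using n by (simp add: f_grad)
    ultimately have "(\<Sum>i=1..n. \<Psi> (step k p i)) / real (card {1..n}) \<le> (1 - r k) * \<Psi> p + \<eta> k * \<sigma>\<^sup>2"
      unfolding \<Psi>_def step_def X_def fst_conv snd_conv using n
      by (intro accelerated_potential_step[OF _ _ f_lower f_upper _ _ mu eta(1,2) r_pos r_le eta(3) Y_scaled]) auto
    then show ?thesis by simp
  qed

  define a where "a k = expectation (\<lambda>\<omega>. \<Psi> (s k \<omega>))" for k
  have "0 \<le> \<Psi> p" for p
    using u_min[of "fst p"] mu by (simp add: \<Psi>_def)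
  then have a_nonneg: "0 \<le> a k" for k
    unfolding a_def by simp
  have a_rec: "a (k + 1) \<le> (1 - r k) * a k + \<eta> k * \<sigma>\<^sup>2" if "k \<in> {1..T}" for k
    unfolding a_def by (rule expected_potential_step[where s = s, OF s_init s_rec drift that])
  have "a (T + 1) \<le> exp (- (\<Sum>i=1..T. r i)) * a 1 + (\<Sum>k=1..T. \<eta> k * \<sigma>\<^sup>2 * exp (- (\<Sum>i=k+1..T. r i)))"
    by (rule unroll_contraction[where T = T and a = a and \<theta> = r and e = "\<lambda>k. \<eta> k * \<sigma>\<^sup>2",
          OF a_rec a_nonneg order_refl])
  moreover have "\<Delta> (T + 1) \<le> a (T + 1)"
    unfolding Delta_eq a_def
  proof (rule integral_mono)
    show "integrable M (\<lambda>\<omega>. f (w (T + 1) \<omega>) - fstar)"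
      using recursive_state_integrable[where s = s and \<Psi> = "\<lambda>p. f (fst p) - fstar" and k = "T + 1", OF s_init s_rec]
      by (simp add: s_def)
    show "integrable M (\<lambda>\<omega>. \<Psi> (s (T + 1) \<omega>))"
      using recursive_state_integrable[where s = s and \<Psi> = \<Psi> and k = "T + 1", OF s_init s_rec] by simp
  qed (use mu in \<open>simp add: s_def \<Psi>_def fstar\<close>)
  \<comment> \<open>The momentum starts at the iterate, so quadratic growth bounds the initial potential; this is
    the factor 2 of the first term.\<close>
  moreover have "a 1 \<le> 2 * \<Delta> 1"
  proof -
    have "a 1 = expectation (\<lambda>\<omega>. \<Psi> (x\<^sub>1, x\<^sub>1))"
      unfolding a_def using s_init by (intro Bochner_Integration.integral_cong) auto
    moreover have "\<Delta> 1 = expectation (\<lambda>\<omega>. f x\<^sub>1 - f u)"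
      unfolding Delta_eq fstar using w_init by (intro Bochner_Integration.integral_cong) auto
    ultimately show ?thesis
      using growth[of x\<^sub>1] by (simp add: prob_space \<Psi>_def)
  qed
  then have "exp (- (\<Sum>i=1..T. r i)) * a 1
      \<le> (c\<^sub>3 * exp (- (real T / sqrt \<kappa>) * (\<alpha> / ?l))) * (2 * \<Delta> 1)"
    using total_decay[OF c(1)] a_nonneg[of 1]
    by (intro mult_mono) (auto simp: r c3_eq c_kappa[symmetric])
  moreover have "(\<Sum>k=1..T. \<eta> k * \<sigma>\<^sup>2 * exp (- (\<Sum>i=k+1..T. r i)))
      \<le> 4 * \<sigma>\<^sup>2 * c\<^sub>3 / (\<mu> * (exp 1)\<^sup>2) * (?l\<^sup>2 / (\<alpha>\<^sup>2 * real T))"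
  proof -
    have "(\<Sum>k=1..T. \<eta> k * \<sigma>\<^sup>2 * exp (- (\<Sum>i=k+1..T. r i)))
        = \<sigma>\<^sup>2 / L * (\<Sum>k=1..T. (\<alpha> ^ k)\<^sup>2 * exp (- (\<Sum>i=k+1..T. c * \<alpha> ^ i)))"
      unfolding sum_distrib_left by (intro sum.cong) (auto simp: \<eta>_def r)
    also have "\<dots> \<le> \<sigma>\<^sup>2 / L * (exp (2 * \<beta> * c / ?l) * 4 / (c\<^sup>2 * (exp 1)\<^sup>2) * (?l\<^sup>2 / (\<alpha>\<^sup>2 * real T)))"
      using noise_sum[OF c(1)] L by (intro mult_left_mono) auto
    also have "exp (2 * \<beta> * c / ?l) = c\<^sub>3"
      by (simp add: c3_eq c_kappa[symmetric])
    also have "\<sigma>\<^sup>2 / L * (c\<^sub>3 * 4 / (c\<^sup>2 * (exp 1)\<^sup>2) * (?l\<^sup>2 / (\<alpha>\<^sup>2 * real T)))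
        = 4 * \<sigma>\<^sup>2 * c\<^sub>3 / (\<mu> * (exp 1)\<^sup>2) * (?l\<^sup>2 / (\<alpha>\<^sup>2 * real T))"
      using L mu by (simp add: c(3))
    finally show ?thesis .
  qed
  ultimately show ?thesis
    by (simp add: mult_ac)
qed

end
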